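(* Let $G$ be a finitely generated group. Then the following are equivalent. (1) $G$ is free abelian. (2) $G$ is $1$-locally testable. (3) There is a finite symmetric generating set $X$ of $G$ such that the syntactic semigroup $\mathrm{SS}(\mathrm{Geo}(G,X))$ of $\mathrm{Geo}(G,X)$ is idempotent (i.e. every element $s$ of it satisfies $s^2=s$).
   Context: A generating set $X$ of a group $G$ is symmetric if it is closed under taking inverses. For a finite symmetric generating set $X$ of $G$, $\mathrm{Geo}(G,X)\subseteq X^*$ denotes the set of all words over $X$ that label geodesic paths in the Cayley graph of $G$ with respect to $X$, i.e. the words $w$ such that no strictly shorter word over $X$ represents the same element of $G$ as $w$. Here $X^*$ is the free monoid over $X$ (all words, including the empty word), $X^+$ is the free semigroup (all non-empty words), and $l(w)$ is the length of $w$. For a natural number $k>0$ and $u\in X^*$ with $l(u)\ge k$, let $\mathrm{pre}_k(u)$ and $\mathrm{suf}_k(u)$ be the prefix and suffix of $u$ of length $k$, and $\mathrm{sub}_k(u)$ the set of all contiguous subwords of $u$ of length $k$; if $l(u)<k$ put $\mathrm{pre}_k(u)=\mathrm{suf}_k(u)=u$ and $\mathrm{sub}_k(u)=\emptyset$; $\mathrm{pre}_0(u)$ and $\mathrm{suf}_0(u)$ are the empty word. Write $u\sim_k v$ if $\mathrm{pre}_{k-1}(u)=\mathrm{pre}_{k-1}(v)$, $\mathrm{suf}_{k-1}(u)=\mathrm{suf}_{k-1}(v)$ and $\mathrm{sub}_k(u)=\mathrm{sub}_k(v)$. A language $L\subseteq X^*$ is $k$-locally testable if it is a union of equivalence classes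 of $\sim_k$. (For $k=1$: membership of a word in $L$ depends only on the set of letters occurring in it.) A group $G$ is $k$-locally testable if $\mathrm{Geo}(G,X)$ is $k$-locally testable for some finite symmetric generating set $X$ of $G$. The syntactic semigroup of $L\subseteq X^*$ is $\mathrm{SS}(L)=X^+/\!\sim_L$, where $u\sim_L v$ if and only if, for all $s,t\in X^*$, the words $sut$ and $svt$ are either both in $L$ or both not in $L$. *)

theory Defs
  imports "HOL-Algebra.Generated_Groups" "HOL-Algebra.Free_Abelian_Groups" "HOL-Library.Sublist"
begin

text \<open>Words over an alphabet \<open>X\<close> are the elements of \<open>lists X\<close>; contiguous subwords are given by
  \<open>sublist\<close>.\<close>

section \<open>Groups and geodesics\<close>

definition fin_sym_gen_set :: "('a, 'b) monoid_scheme \<Rightarrow> 'a set \<Rightarrow> bool" where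
  "fin_sym_gen_set G X \<longleftrightarrow>
     finite X \<and> X \<subseteq> carrier G \<and> (\<forall>x\<in>X. inv\<^bsub>G\<^esub> x \<in> X) \<and> generate G X = carrier G"

definition finitely_generated_group :: "('a, 'b) monoid_scheme \<Rightarrow> bool" where
  "finitely_generated_group G \<longleftrightarrow>
     group G \<and> (\<exists>X. finite X \<and> X \<subseteq> carrier G \<and> generate G X = carrier G)"

text \<open>The basis may be taken in the type of the elements of \<open>G\<close> without loss of generality,
  as a basis of \<open>G\<close> is a subset of its carrier.\<close>

definition is_free_abelian :: "('a, 'b) monoid_scheme \<Rightarrow> bool" where
  "is_free_abelian G \<longleftrightarrow> (\<exists>S :: 'a set. G \<cong> free_Abelian_group S)"

definition word_value :: "('a, 'b) monoid_scheme \<Rightarrow> 'a list \<Rightarrow> 'a" where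
  "word_value G w = foldr (\<otimes>\<^bsub>G\<^esub>) w \<one>\<^bsub>G\<^esub>"

definition Geo :: "('a, 'b) monoid_scheme \<Rightarrow> 'a set \<Rightarrow> 'a list set" where
  "Geo G X = {w \<in> lists X. \<not> (\<exists>v \<in> lists X. length v < length w \<and> word_value G v = word_value G w)}"

section \<open>Locally testable languages\<close>

text \<open>For a word of length less than \<open>k\<close>, the first two functions return the word
  itself, and the third one (for \<open>k > 0\<close>) the empty set.\<close>

definition pre :: "nat \<Rightarrow> 'a list \<Rightarrow> 'a list" where
  "pre k u = take k u"

definition suf :: "nat \<Rightarrow> 'a list \<Rightarrow> 'a list" where
  "suf k u = drop (length u - k) u"

definition sub :: "nat \<Rightarrow> 'a list \<Rightarrow> 'a list set" where
  "sub k u = {v. sublist v u \<and> length v = k}"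

definition loc_rel :: "nat \<Rightarrow> 'a set \<Rightarrow> ('a list \<times> 'a list) set" where
  "loc_rel k X = {(u, v) \<in> lists X \<times> lists X.
     pre (k - 1) u = pre (k - 1) v \<and> suf (k - 1) u = suf (k - 1) v \<and> sub k u = sub k v}"

definition locally_testable :: "nat \<Rightarrow> 'a set \<Rightarrow> 'a list set \<Rightarrow> bool" where
  "locally_testable k X L \<longleftrightarrow> 0 < k \<and> (\<exists>C \<subseteq> lists X // loc_rel k X. L = \<Union>C)"

definition locally_testable_group :: "nat \<Rightarrow> ('a, 'b) monoid_scheme \<Rightarrow> bool" where
  "locally_testable_group k G \<longleftrightarrow>
     (\<exists>X. fin_sym_gen_set G X \<and> locally_testable k X (Geo G X))"

section \<open>The syntactic semigroup\<close>

definition nonempty_words :: "'a set \<Rightarrow> 'a list set" where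
  "nonempty_words X = lists X - {[]}"

definition syn_rel :: "'a set \<Rightarrow> 'a list set \<Rightarrow> ('a list \<times> 'a list) set" where
  "syn_rel X L = {(u, v) \<in> nonempty_words X \<times> nonempty_words X.
     \<forall>s \<in> lists X. \<forall>t \<in> lists X. s @ u @ t \<in> L \<longleftrightarrow> s @ v @ t \<in> L}"

definition SS :: "'a set \<Rightarrow> 'a list set \<Rightarrow> 'a list set set" where
  "SS X L = nonempty_words X // syn_rel X L"

definition SS_mult :: "'a set \<Rightarrow> 'a list set \<Rightarrow> 'a list set \<Rightarrow> 'a list set \<Rightarrow> 'a list set" where
  "SS_mult X L A B = (\<Union>u\<in>A. \<Union>v\<in>B. syn_rel X L `` {u @ v})"

definition SS_idempotent :: "'a set \<Rightarrow> 'a list set \<Rightarrow> bool" where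
  "SS_idempotent X L \<longleftrightarrow> (\<forall>s \<in> SS X L. SS_mult X L s s = s)"

lemma equiv_loc_rel: "equiv (lists X) (loc_rel k X)"
  by (rule equivI) (auto simp: loc_rel_def refl_on_def sym_def trans_def)

lemma equiv_syn_rel: "equiv (nonempty_words X) (syn_rel X L)"
  by (rule equivI) (auto simp: syn_rel_def refl_on_def sym_def trans_def)

lemma syn_rel_append:
  assumes "(u, u') \<in> syn_rel X L" "(v, v') \<in> syn_rel X L"
  shows "(u @ v, u' @ v') \<in> syn_rel X L"
proof -
  have mem: "u \<in> nonempty_words X" "u' \<in> nonempty_words X"
    "v \<in> nonempty_words X" "v' \<in> nonempty_words X"
    using assms by (auto simp: syn_rel_def)
  have "s @ (u @ v) @ t \<in> L \<longleftrightarrow> s @ (u' @ v') @ t \<in> L"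
    if st: "s \<in> lists X" "t \<in> lists X" for s t
  proof -
    have "v @ t \<in> lists X" "s @ u' \<in> lists X"
      using st mem by (auto simp: nonempty_words_def)
    then have "s @ u @ (v @ t) \<in> L \<longleftrightarrow> s @ u' @ (v @ t) \<in> L"
      and "(s @ u') @ v @ t \<in> L \<longleftrightarrow> (s @ u') @ v' @ t \<in> L"
      using assms st unfolding syn_rel_def by blast+
    then show ?thesis by simp
  qed
  then show ?thesis
    using mem by (auto simp: syn_rel_def nonempty_words_def)
qed

lemma SS_mult_class:
  assumes "u \<in> nonempty_words X" "v \<in> nonempty_words X"
  shows "SS_mult X L (syn_rel X L `` {u}) (syn_rel X L `` {v}) = syn_rel X L `` {u @ v}"
  unfolding SS_mult_def
proof (rule UN_equiv_class2 [OF equiv_syn_rel equiv_syn_rel _ assms])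
  show "congruent2 (syn_rel X L) (syn_rel X L) (\<lambda>u v. syn_rel X L `` {u @ v})"
    by (auto simp: congruent2_def intro!: equiv_class_eq [OF equiv_syn_rel] syn_rel_append)
qed

end

theory Submission
  imports Defs
begin

text \<open>
  If \<open>G\<close> is free abelian and \<open>X\<close> consists of a basis and the inverses of the basis elements, then
  a word is geodesic exactly if no letter occurs in it together with its inverse. This depends only
  on the set of letters of the word, so the geodesics are 1-locally testable
  (\<open>free_abelian_imp_locally_testable_1\<close>). If membership depends only on the set of letters, then
  doubling a factor of a word never matters, so the syntactic semigroup is idempotent, for the same
  \<open>X\<close> (\<open>locally_testable_1_imp_SS_idempotent\<close>).

  The substance is the way back from idempotency to freeness. Idempotency says that a non-empty
  factor of a word may be replaced by any positive power of itself without affecting whether the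
  word is geodesic (\<open>power_factor\<close>). Hence \<open>u\<^sup>n\<close> is geodesic whenever \<open>u\<close> is: the word length
  satisfies \<open>\<bar>g\<^sup>n\<bar> = n \<bar>g\<bar>\<close>, and \<open>G\<close> is torsion-free. A conjugate \<open>x y x\<^sup>-\<^sup>1\<close> of a non-trivial letter
  by a letter is again a letter, because its \<open>n\<close>-th power has length \<open>n \<bar>x y x\<^sup>-\<^sup>1\<bar>\<close> but is spelled by
  \<open>x y\<^sup>n x\<^sup>-\<^sup>1\<close>, of length \<open>n + 2\<close>. So conjugation by \<open>x\<close> permutes a finite set, and for any two
  letters some positive power of one commutes with the other. A second consequence is that a word is
  geodesic if its letters, possibly different, are non-trivial and have a common positive power
  (\<open>Geo_common_power\<close>): replacing each letter by that power turns the word into a power of one letter.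

  Now let \<open>x\<close>, \<open>y\<close> be letters, \<open>v = y x y\<^sup>-\<^sup>1\<close>, and let \<open>x\<^sup>N\<close> commute with \<open>y\<close>, so that \<open>v\<^sup>N = x\<^sup>N\<close>.
  Suppose that \<open>w = x v\<^sup>-\<^sup>1\<close> is not trivial. If \<open>w\<close> has length 2, then \<open>x v\<^sup>-\<^sup>1\<close> is a geodesic word,
  and so is \<open>x\<^sup>N v\<^sup>-\<^sup>N\<close>, although its value is trivial. If \<open>w\<close> is a letter, then \<open>x\<^sup>N v\<^sup>-\<^sup>N\<close> is the
  product of the letters \<open>v\<^sup>i w v\<^sup>-\<^sup>i\<close> for \<open>i < N\<close>; these have a common power, so they form a geodesic
  word of length \<open>N\<close>, again with trivial value. Both are absurd, so \<open>x = v\<close>, the letters commute, and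
  \<open>G\<close> is abelian (\<open>letters_commute\<close>). A finitely generated torsion-free abelian group is free: a
  generating set of minimal size is independent (\<open>minimal_generators_independent\<close>), since a
  shortest non-trivial relation could be shortened by a step of the Euclidean algorithm on two of its
  coefficients.
\<close>

section \<open>Word values and geodesics\<close>

context group
begin

lemma word_value_Nil [simp]: "word_value G [] = \<one>"
  by (simp add: word_value_def)

lemma word_value_Cons [simp]: "word_value G (x # w) = x \<otimes> word_value G w"
  by (simp add: word_value_def)

lemma word_value_closed [simp]: "set w \<subseteq> carrier G \<Longrightarrow> word_value G w \<in> carrier G"
  by (induction w) auto

lemma word_value_append [simp]:
  "set u \<subseteq> carrier G \<Longrightarrow> set v \<subseteq> carrier G \<Longrightarrow>
    word_value G (u @ v) = word_value G u \<otimes> word_value G v"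
  by (induction u) (auto simp: m_assoc)

lemma word_value_concat_replicate:
  assumes "set u \<subseteq> carrier G"
  shows "word_value G (concat (replicate n u)) = word_value G u [^] n"
proof (induction n)
  case (Suc n)
  have "set (concat (replicate n u)) \<subseteq> carrier G"
    using assms by (auto split: if_splits)
  then have "word_value G (concat (replicate (Suc n) u)) = word_value G u \<otimes> word_value G u [^] n"
    using Suc assms by simp
  also have "\<dots> = word_value G u [^] Suc n"
    using assms by (intro nat_pow_Suc2 [symmetric]) simp
  finally show ?case .
qed simp

lemma word_value_replicate:
  assumes "x \<in> carrier G"
  shows "word_value G (replicate n x) = x [^] n"
proof -
  have "replicate n x = concat (replicate n [x])"
    by (induction n) auto
  then show ?thesis
    using word_value_concat_replicate [of "[x]" n] assms by simp
qed

lemma inv_mult_cancel: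
  "a \<in> carrier G \<Longrightarrow> z \<in> carrier G \<Longrightarrow> inv a \<otimes> (a \<otimes> z) = z"
  by (simp flip: m_assoc)

lemma conjugate_pow:
  assumes "a \<in> carrier G" "b \<in> carrier G"
  shows "(a \<otimes> b \<otimes> inv a) [^] (n::nat) = a \<otimes> b [^] n \<otimes> inv a"
proof (induction n)
  case (Suc n)
  with assms show ?case
    by (simp add: m_assoc inv_mult_cancel)
qed (use assms in simp)

lemma conjugate_ne_one:
  assumes "a \<in> carrier G" "b \<in> carrier G" "b \<noteq> \<one>"
  shows "a \<otimes> b \<otimes> inv a \<noteq> \<one>"
  using assms by (simp add: inv_solve_right' r_cancel_one)

end

locale sym_gen_group = group G for G (structure) and X +
  assumes gens: "fin_sym_gen_set G X"
begin

lemma finite_gens: "finite X"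
  and gens_carrier: "X \<subseteq> carrier G"
  and inv_gens: "x \<in> X \<Longrightarrow> inv x \<in> X"
  and generate_gens: "generate G X = carrier G"
  using gens by (auto simp: fin_sym_gen_set_def)

lemma gen_closed [simp]: "x \<in> X \<Longrightarrow> x \<in> carrier G"
  using gens_carrier by blast

lemma words_carrier [simp]: "w \<in> lists X \<Longrightarrow> set w \<subseteq> carrier G"
  using gens_carrier by auto

lemma ex_word:
  assumes "g \<in> carrier G"
  shows "\<exists>w \<in> lists X. word_value G w = g"
proof -
  have "g \<in> generate G X"
    using assms generate_gens by simp
  then show ?thesis
  proof induction
    case one
    show ?case by (rule bexI [of _ "[]"]) auto
  next
    case (incl h)
    then show ?case by (intro bexI [of _ "[h]"]) auto
  next
    case (inv h)
    then show ?case by (intro bexI [of _ "[inv h]"]) (auto simp: inv_gens)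
  next
    case (eng g h)
    then obtain u v where "u \<in> lists X" "v \<in> lists X" "word_value G u = g" "word_value G v = h"
      by blast
    then show ?case by (intro bexI [of _ "u @ v"]) auto
  qed
qed

lemma Geo_words: "u \<in> Geo G X \<Longrightarrow> u \<in> lists X"
  by (simp add: Geo_def)

lemma Geo_length_le:
  "u \<in> Geo G X \<Longrightarrow> v \<in> lists X \<Longrightarrow> word_value G v = word_value G u \<Longrightarrow> length u \<le> length v"
  unfolding Geo_def by (auto simp: not_less)

lemma Geo_transfer:
  assumes "u \<in> Geo G X" "v \<in> lists X" "word_value G v = word_value G u" "length v \<le> length u"
  shows "v \<in> Geo G X"
  using assms unfolding Geo_def by force

lemma ex_Geo:
  assumes "g \<in> carrier G"
  shows "\<exists>u \<in> Geo G X. word_value G u = g"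
proof -
  obtain u where u: "u \<in> lists X \<and> word_value G u = g"
    and min: "\<forall>v. v \<in> lists X \<and> word_value G v = g \<longrightarrow> length u \<le> length v"
    using ex_has_least_nat [of "\<lambda>w. w \<in> lists X \<and> word_value G w = g"] ex_word [OF assms] by blast
  then have "u \<in> Geo G X"
    by (auto simp: Geo_def not_less)
  with u show ?thesis by blast
qed

lemma nontrivial_letter_Geo:
  assumes "x \<in> X" "x \<noteq> \<one>"
  shows "[x] \<in> Geo G X"
  using assms by (auto simp: Geo_def)

lemma Geo_value_one_iff:
  assumes "u \<in> Geo G X"
  shows "word_value G u = \<one> \<longleftrightarrow> u = []"
  using Geo_length_le [OF assms, of "[]"] by auto

end

section \<open>Idempotent syntactic semigroups force commutativity\<close>

locale idempotent_geodesics = sym_gen_group +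
  assumes idem: "SS_idempotent X (Geo G X)"
begin

text \<open>The class of \<open>u u\<close> in the syntactic semigroup is the square of the class of \<open>u\<close>.\<close>

lemma square_factor:
  assumes u: "u \<in> lists X" "u \<noteq> []" and st: "s \<in> lists X" "t \<in> lists X"
  shows "s @ u @ u @ t \<in> Geo G X \<longleftrightarrow> s @ u @ t \<in> Geo G X"
proof -
  let ?r = "syn_rel X (Geo G X)"
  have u: "u \<in> nonempty_words X"
    using u by (simp add: nonempty_words_def)
  then have "?r `` {u} \<in> SS X (Geo G X)"
    by (auto simp: SS_def quotient_def)
  then have "SS_mult X (Geo G X) (?r `` {u}) (?r `` {u}) = ?r `` {u}"
    using idem unfolding SS_idempotent_def by blast
  then have "?r `` {u @ u} = ?r `` {u}"
    using SS_mult_class [OF u u, of "Geo G X"] by simp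
  then have "(u @ u, u) \<in> ?r"
    using eq_equiv_class [OF _ equiv_syn_rel u] by blast
  then have "s @ (u @ u) @ t \<in> Geo G X \<longleftrightarrow> s @ u @ t \<in> Geo G X"
    using st unfolding syn_rel_def by blast
  then show ?thesis by simp
qed

lemma power_factor:
  assumes u: "u \<in> lists X" "u \<noteq> []" and st: "s \<in> lists X" "t \<in> lists X" and n: "n > 0"
  shows "s @ concat (replicate n u) @ t \<in> Geo G X \<longleftrightarrow> s @ u @ t \<in> Geo G X"
  using n
proof (induction n rule: nat_induct_non_zero)
  case (Suc n)
  have len: "concat (replicate k u) \<in> lists X" for k
    using u by (induction k) auto
  obtain m where m: "n = Suc m"
    using Suc.hyps by (metis gr0_implies_Suc)
  have "s @ concat (replicate (Suc n) u) @ t \<in> Geo G X \<longleftrightarrow>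
      s @ u @ u @ (concat (replicate m u) @ t) \<in> Geo G X"
    by (simp add: m)
  also have "\<dots> \<longleftrightarrow> s @ u @ (concat (replicate m u) @ t) \<in> Geo G X"
    using len u st by (intro square_factor) auto
  also have "\<dots> \<longleftrightarrow> s @ u @ t \<in> Geo G X"
    using Suc.IH by (simp add: m)
  finally show ?case .
qed simp

lemma Geo_power:
  assumes "u \<in> Geo G X"
  shows "concat (replicate n u) \<in> Geo G X"
proof (cases "n = 0 \<or> u = []")
  case True
  then show ?thesis
    by (auto simp: Geo_def)
next
  case False
  then show ?thesis
    using power_factor [of u "[]" "[]" n] assms Geo_words [OF assms] by simp
qed

text \<open>A geodesic word for \<open>g\<close> is non-empty, and its powers are geodesic and non-empty.\<close>

lemma torsion_free:
  assumes g: "g \<in> carrier G" "g \<noteq> \<one>" and n: "n > 0"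
  shows "g [^] (n::nat) \<noteq> \<one>"
proof -
  obtain u where u: "u \<in> Geo G X" "word_value G u = g"
    using ex_Geo g by blast
  then have ne: "u \<noteq> []"
    using g by auto
  have "concat (replicate n u) \<noteq> []"
    using ne n by (cases n) auto
  then have "word_value G (concat (replicate n u)) \<noteq> \<one>"
    using Geo_value_one_iff [OF Geo_power [OF u(1)]] by simp
  then show ?thesis
    using u Geo_words [OF u(1)] by (simp add: word_value_concat_replicate)
qed

text \<open>The word length satisfies \<open>n \<bar>x y x\<^sup>-\<^sup>1\<bar> = \<bar>x y\<^sup>n x\<^sup>-\<^sup>1\<bar> \<le> n + 2\<close>. Any \<open>n > 2\<close> forces
  \<open>\<bar>x y x\<^sup>-\<^sup>1\<bar> \<le> 1\<close>, and the proof takes \<open>n = 3\<close>.\<close>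

lemma conjugate_letter:
  assumes x: "x \<in> X" and y: "y \<in> X" "y \<noteq> \<one>"
  shows "x \<otimes> y \<otimes> inv x \<in> X"
proof -
  let ?g = "x \<otimes> y \<otimes> inv x"
  obtain u where u: "u \<in> Geo G X" "word_value G u = ?g"
    using ex_Geo [of ?g] x y by auto
  let ?v = "x # replicate 3 y @ [inv x]"
  have v: "?v \<in> lists X"
    using x y inv_gens by auto
  have "word_value G ?v = x \<otimes> (y [^] (3::nat) \<otimes> inv x)"
    using x y by (simp add: word_value_replicate subset_iff)
  also have "\<dots> = x \<otimes> y [^] (3::nat) \<otimes> inv x"
    using x y by (simp add: m_assoc)
  also have "\<dots> = word_value G (concat (replicate 3 u))"
    using x y u Geo_words [OF u(1)] by (simp add: word_value_concat_replicate conjugate_pow)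
  finally have "length (concat (replicate 3 u)) \<le> length ?v"
    by (intro Geo_length_le Geo_power u v)
  then have "length u \<le> 1"
    by (simp add: length_concat numeral_3_eq_3)
  moreover have "?g \<noteq> \<one>"
    using x y by (simp add: conjugate_ne_one)
  then have "u \<noteq> []"
    using u by auto
  ultimately obtain z where "u = [z]"
    by (cases u) auto
  then show ?thesis
    using u Geo_words [OF u(1)] by auto
qed

lemma conjugate_letter_pow:
  assumes x: "x \<in> X" and y: "y \<in> X" "y \<noteq> \<one>"
  shows "x [^] (n::nat) \<otimes> y \<otimes> inv (x [^] n) \<in> X"
proof (induction n)
  case 0
  then show ?case using y by simp
next
  case (Suc n)
  let ?z = "x [^] n \<otimes> y \<otimes> inv (x [^] n)"
  have "x \<otimes> ?z \<otimes> inv x \<in> X"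
    using x y by (intro conjugate_letter [OF x Suc] conjugate_ne_one) auto
  also have "x \<otimes> ?z \<otimes> inv x = x [^] Suc n \<otimes> y \<otimes> inv (x [^] Suc n)"
  proof -
    have "x [^] Suc n = x \<otimes> x [^] n"
      using x by (intro nat_pow_Suc2) simp
    then show ?thesis
      using x y by (simp add: inv_mult_group m_assoc del: nat_pow_Suc)
  qed
  finally show ?case .
qed

text \<open>All conjugates of \<open>y\<close> by powers of \<open>x\<close> lie in the finite set \<open>X\<close>, so two of them coincide.\<close>

lemma some_power_commutes:
  assumes x: "x \<in> X" and y: "y \<in> X" "y \<noteq> \<one>"
  obtains n :: nat where "n > 0" "x [^] n \<otimes> y = y \<otimes> x [^] n"
proof -
  let ?f = "\<lambda>n::nat. x [^] n \<otimes> y \<otimes> inv (x [^] n)"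
  have "range ?f \<subseteq> X"
    using conjugate_letter_pow assms by auto
  then have "\<not> inj ?f"
    using finite_gens finite_imageD finite_subset infinite_UNIV_nat by blast
  then obtain i j :: nat where ij: "i < j" "?f i = ?f j"
    unfolding inj_on_def by (metis linorder_neqE_nat)
  define n where "n = j - i"
  have j: "j = i + n"
    using ij by (simp add: n_def)
  have c: "x \<in> carrier G" "y \<in> carrier G"
    using x y by auto
  let ?z = "x [^] n \<otimes> y \<otimes> inv (x [^] n)"
  have "x [^] i \<otimes> ?z \<otimes> inv (x [^] i) = ?f j"
    using c by (simp add: j inv_mult_group m_assoc flip: nat_pow_mult)
  then have "x [^] i \<otimes> ?z \<otimes> inv (x [^] i) = x [^] i \<otimes> y \<otimes> inv (x [^] i)"
    using ij(2) by simp
  then have "?z = y"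
    using c by simp
  then have "y \<otimes> x [^] n = x [^] n \<otimes> y"
    using c by (simp add: inv_solve_right')
  then show thesis
    using that [of n] ij by (simp add: n_def)
qed

lemma Geo_letter_powers:
  assumes "set us \<subseteq> X" "s \<in> lists X" "M > 0"
  shows "s @ concat (map (replicate M) us) \<in> Geo G X \<longleftrightarrow> s @ us \<in> Geo G X"
  using assms
proof (induction us arbitrary: s)
  case (Cons a us)
  have rep: "concat (replicate M [a]) = replicate M a"
    by (induction M) auto
  have mem: "concat (map (replicate M) us) \<in> lists X"
    using Cons.prems by auto
  have "s @ replicate M a @ concat (map (replicate M) us) \<in> Geo G X \<longleftrightarrow>
      s @ [a] @ concat (map (replicate M) us) \<in> Geo G X"
    using power_factor [of "[a]" s "concat (map (replicate M) us)" M] Cons.prems mem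
    by (simp add: rep)
  then show ?case
    using Cons.IH [of "s @ [a]"] Cons.prems by simp
qed simp

text \<open>Raising every letter of \<open>us\<close> to the power \<open>M\<close> gives a word that has the value and the length of
  \<open>w\<^sup>M\<^sup>n\<close>, where \<open>n\<close> is the length of \<open>us\<close>. The latter is geodesic, hence so is the former, and
  the powers can be contracted again.\<close>

lemma Geo_common_power:
  assumes us: "set us \<subseteq> X" and w: "w \<in> X" "w \<noteq> \<one>" and M: "M > 0"
    and pow: "\<And>u. u \<in> set us \<Longrightarrow> u [^] M = w [^] (M::nat)"
  shows "us \<in> Geo G X"
proof -
  let ?v = "concat (map (replicate M) us)" and ?r = "replicate (M * length us) w"
  have val: "word_value G ?v = w [^] (M * length us)"
    using us pow
  proof (induction us)
    case (Cons a us)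
    have "set (concat (map (replicate M) us)) \<subseteq> carrier G"
      using Cons.prems gens_carrier by auto
    moreover have "set (replicate M a) \<subseteq> carrier G"
      using Cons.prems gens_carrier by auto
    ultimately show ?case
      using Cons w by (simp add: word_value_replicate nat_pow_mult)
  qed simp
  have r: "?r \<in> Geo G X"
  proof -
    have "concat (replicate n [w]) = replicate n w" for n
      by (induction n) auto
    then show ?thesis
      using Geo_power [OF nontrivial_letter_Geo [OF w]] by metis
  qed
  have v: "?v \<in> lists X"
    using us by auto
  have "length ?v = M * length us"
    by (induction us) auto
  then have "?v \<in> Geo G X"
    using Geo_transfer [OF r v] val w by (simp add: word_value_replicate)
  then show ?thesis
    using Geo_letter_powers [of us "[]" M] us M by simp
qed

lemma letters_commute:
  assumes x: "x \<in> X" and y: "y \<in> X"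
  shows "x \<otimes> y = y \<otimes> x"
proof (cases "x = \<one> \<or> y = \<one>")
  case True
  then show ?thesis using x y by auto
next
  case False
  define v where "v = y \<otimes> x \<otimes> inv y"
  have c: "x \<in> carrier G" "y \<in> carrier G"
    using x y by auto
  have v: "v \<in> X" "v \<noteq> \<one>"
    using conjugate_letter conjugate_ne_one x y False by (auto simp: v_def)
  have cv: "v \<in> carrier G"
    using v by simp
  obtain N :: nat where N: "N > 0" "x [^] N \<otimes> y = y \<otimes> x [^] N"
    using some_power_commutes x y False by blast
  have "v [^] N = x [^] N"
    using c unfolding v_def by (simp add: conjugate_pow inv_solve_right' N(2))
  then have rel: "x [^] N \<otimes> inv (v [^] N) = \<one>"
    using c by simp
  have "x = v"
  proof (rule ccontr)
    assume "x \<noteq> v"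
    define w where "w = x \<otimes> inv v"
    have cw: "w \<in> carrier G" and w1: "w \<noteq> \<one>"
      using \<open>x \<noteq> v\<close> c cv by (auto simp: w_def inv_solve_right')
    \<comment> \<open>In both cases some geodesic word, not empty as \<open>N > 0\<close>, spells \<open>x\<^sup>N v\<^sup>-\<^sup>N = 1\<close>.\<close>
    show False
    proof (cases "w \<in> X")
      case True
      obtain M :: nat where M: "M > 0" "w [^] M \<otimes> v = v \<otimes> w [^] M"
        using some_power_commutes [OF True v] by blast
      \<comment> \<open>The product of the \<open>f i\<close> telescopes, since \<open>x\<^sup>n v\<^sup>-\<^sup>n f\<^sub>n = x\<^sup>n w v\<^sup>-\<^sup>n = x\<^sup>n\<^sup>+\<^sup>1 v\<^sup>-\<^sup>n\<^sup>-\<^sup>1\<close>.\<close>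
      define f where "f i = v [^] i \<otimes> w \<otimes> inv (v [^] i)" for i :: nat
      let ?us = "map f [0..<N]"
      have fX: "f i \<in> X" for i
        unfolding f_def using conjugate_letter_pow v(1) True w1 by blast
      have "f i [^] M = w [^] M" for i
      proof -
        have "v [^] i \<otimes> w [^] M = w [^] M \<otimes> v [^] i"
          using group_commutes_pow [of v "w [^] M" i] M cv cw by simp
        then show ?thesis
          unfolding f_def using cv cw by (simp add: conjugate_pow inv_solve_right')
      qed
      then have "?us \<in> Geo G X"
        using fX True w1 M by (intro Geo_common_power [of _ w M]) auto
      moreover have "word_value G (map f [0..<n]) = x [^] n \<otimes> inv (v [^] n)" for n
      proof (induction n)
        case (Suc n)
        have "set (map f [0..<n]) \<subseteq> carrier G"
          using fX gens_carrier by auto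
        then have "word_value G (map f [0..<Suc n]) = x [^] n \<otimes> inv (v [^] n) \<otimes> f n"
          using Suc fX by (simp)
        also have "\<dots> = x [^] n \<otimes> (x \<otimes> inv v) \<otimes> inv (v [^] n)"
          using c cv by (simp add: f_def w_def m_assoc inv_mult_cancel)
        also have "\<dots> = x [^] n \<otimes> x \<otimes> inv (v [^] n \<otimes> v)"
          using c cv by (simp add: inv_mult_group m_assoc)
        also have "\<dots> = x [^] Suc n \<otimes> inv (v [^] Suc n)"
          by simp
        finally show ?case .
      qed simp
      ultimately have "?us = []"
        using Geo_value_one_iff rel by metis
      then show False
        using N by simp
    next
      case False
      have iv: "inv v \<in> X"
        using v inv_gens by blast
      have "[x, inv v] \<in> Geo G X"
      proof -
        obtain u where u: "u \<in> Geo G X" "word_value G u = w"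
          using ex_Geo cw by blast
        then have "length u \<ge> 2"
          using False w1 Geo_words [OF u(1)] by (cases u; cases "tl u") auto
        then show ?thesis
          using Geo_transfer [OF u(1), of "[x, inv v]"] x iv c cv u(2) by (simp add: w_def)
      qed
      then have "replicate N x @ replicate N (inv v) \<in> Geo G X"
        using Geo_letter_powers [of "[x, inv v]" "[]" N] x iv N by simp
      moreover have "word_value G (replicate N x @ replicate N (inv v)) = \<one>"
        using c cv rel by (simp add: word_value_replicate subset_iff nat_pow_inv)
      ultimately show False
        using N Geo_value_one_iff by fastforce
    qed
  qed
  then have "x = y \<otimes> x \<otimes> inv y"
    by (simp add: v_def)
  then show ?thesis
    using c by (simp add: inv_solve_right)
qed

lemma commutative: "comm_group G"
proof (rule group_comm_groupI)
  fix g h assume "g \<in> carrier G" "h \<in> carrier G"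
  then obtain u v where u: "u \<in> lists X" "word_value G u = g"
    and v: "v \<in> lists X" "word_value G v = h"
    using ex_word by metis
  have letter: "x \<otimes> word_value G w = word_value G w \<otimes> x" if "x \<in> X" "w \<in> lists X" for x w
    using that(2)
  proof (induction w)
    case (Cons y w)
    then have "x \<otimes> (y \<otimes> word_value G w) = y \<otimes> (x \<otimes> word_value G w)"
      using letters_commute [OF that(1), of y] that(1) by (metis m_assoc gen_closed word_value_closed words_carrier)
    also have "\<dots> = y \<otimes> word_value G w \<otimes> x"
      using Cons that(1) by (simp add: m_assoc)
    finally show ?case by simp
  qed (use that in simp)
  have "word_value G u \<otimes> word_value G v = word_value G v \<otimes> word_value G u"
    using u(1)
  proof (induction u)
    case (Cons x u)
    then have "x \<otimes> word_value G u \<otimes> word_value G v = x \<otimes> word_value G v \<otimes> word_value G u"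
      using v(1) by (simp add: m_assoc)
    also have "\<dots> = word_value G v \<otimes> (x \<otimes> word_value G u)"
      using Cons v(1) letter [of x v] by (simp add: m_assoc)
    finally show ?case by simp
  qed (use \<open>h \<in> carrier G\<close> v in simp)
  then show "g \<otimes> h = h \<otimes> g"
    using u v by simp
qed

end
section \<open>Finitely generated torsion-free abelian groups are free\<close>

abbreviation lookup :: "('c \<Rightarrow>\<^sub>0 int) \<Rightarrow> 'c \<Rightarrow> int" where
  "lookup \<equiv> Poly_Mapping.lookup"

text \<open>The \<open>\<ell>\<^sub>1\<close>-norm on the free abelian group.\<close>

definition frag_norm :: "('c \<Rightarrow>\<^sub>0 int) \<Rightarrow> nat" where
  "frag_norm a = (\<Sum>k\<in>Poly_Mapping.keys a. nat \<bar>lookup a k\<bar>)"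

lemma frag_norm_superset:
  assumes "finite T" "Poly_Mapping.keys a \<subseteq> T"
  shows "frag_norm a = (\<Sum>k\<in>T. nat \<bar>lookup a k\<bar>)"
  unfolding frag_norm_def using assms
  by (intro sum.mono_neutral_left) (auto simp: in_keys_iff)

lemma frag_norm_add_le: "frag_norm (a + b) \<le> frag_norm a + frag_norm b"
proof -
  let ?T = "Poly_Mapping.keys a \<union> Poly_Mapping.keys b"
  have "frag_norm (a + b) = (\<Sum>k\<in>?T. nat \<bar>lookup (a + b) k\<bar>)"
    by (intro frag_norm_superset keys_add) auto
  also have "\<dots> \<le> (\<Sum>k\<in>?T. nat \<bar>lookup a k\<bar> + nat \<bar>lookup b k\<bar>)"
    by (intro sum_mono) (simp add: lookup_add)
  also have "\<dots> = frag_norm a + frag_norm b"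
    by (simp add: sum.distrib frag_norm_superset [of ?T])
  finally show ?thesis .
qed

lemma frag_norm_cmul_of [simp]: "frag_norm (frag_cmul c (frag_of x)) = nat \<bar>c\<bar>"
  by (subst frag_norm_superset [of "{x}"]) auto

lemma frag_norm_update:
  "frag_norm a + nat \<bar>lookup a x + c\<bar> =
    frag_norm (a + frag_cmul c (frag_of x)) + nat \<bar>lookup a x\<bar>"
proof -
  let ?T = "insert x (Poly_Mapping.keys a)" and ?b = "a + frag_cmul c (frag_of x)"
  have "Poly_Mapping.keys ?b \<subseteq> ?T"
    using keys_add [of a "frag_cmul c (frag_of x)"] keys_cmul [of c "frag_of x"] by auto
  then have "frag_norm ?b = (\<Sum>k\<in>?T. nat \<bar>lookup ?b k\<bar>)"
    by (intro frag_norm_superset) auto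
  also have "\<dots> = nat \<bar>lookup a x + c\<bar> + (\<Sum>k\<in>?T - {x}. nat \<bar>lookup ?b k\<bar>)"
    by (subst sum.remove [of _ x]) (auto simp: lookup_add)
  also have "(\<Sum>k\<in>?T - {x}. nat \<bar>lookup ?b k\<bar>) = (\<Sum>k\<in>?T - {x}. nat \<bar>lookup a k\<bar>)"
    by (intro sum.cong) (auto simp: lookup_add lookup_frag_of)
  finally have 1: "frag_norm ?b = nat \<bar>lookup a x + c\<bar> + (\<Sum>k\<in>?T - {x}. nat \<bar>lookup a k\<bar>)" .
  have "frag_norm a = (\<Sum>k\<in>?T. nat \<bar>lookup a k\<bar>)"
    by (intro frag_norm_superset) auto
  also have "\<dots> = nat \<bar>lookup a x\<bar> + (\<Sum>k\<in>?T - {x}. nat \<bar>lookup a k\<bar>)"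
    by (subst sum.remove [of _ x]) auto
  finally show ?thesis
    using 1 by simp
qed

definition fin_gen_set :: "('a, 'b) monoid_scheme \<Rightarrow> 'a set \<Rightarrow> bool" where
  "fin_gen_set G S \<longleftrightarrow> finite S \<and> S \<subseteq> carrier G \<and> generate G S = carrier G"

lemma (in group) fin_gen_set_transfer:
  assumes "fin_gen_set G S" "finite T" "T \<subseteq> carrier G" "S \<subseteq> generate G T"
  shows "fin_gen_set G T"
proof -
  have "generate G S \<subseteq> generate G T"
    using assms generate_subgroup_incl generate_is_subgroup by blast
  then show ?thesis
    using assms generate_incl unfolding fin_gen_set_def by blast
qed

text \<open>The homomorphism \<open>h\<close> evaluates formal combinations of elements of \<open>G\<close>. It is defined for all of
  them at once, so that relations among different generating sets can be compared. Among all
  non-trivial relations of generating sets of minimal size, let \<open>b\<close>, for the generating set \<open>T\<close>,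
  have the least norm. By minimality of the size and torsion-freeness, \<open>b\<close> involves two generators
  \<open>i\<close> and \<open>j\<close>, with coefficients \<open>\<bar>b\<^sub>j\<bar> \<le> \<bar>b\<^sub>i\<bar>\<close>. In additive notation, with \<open>\<epsilon> = \<plusminus>1\<close> the sign of
  \<open>b\<^sub>i b\<^sub>j\<close>, the identity \<open>b\<^sub>i i + b\<^sub>j j = (b\<^sub>i - \<epsilon> b\<^sub>j) i + b\<^sub>j (j + \<epsilon> i)\<close> gives a smaller relation
  for the generating set in which \<open>t = j + \<epsilon> i\<close> replaces \<open>j\<close>.\<close>

lemma (in comm_group) minimal_generators_independent:
  fixes h :: "('a \<Rightarrow>\<^sub>0 int) \<Rightarrow> 'a"
  assumes tf: "\<And>g n. g \<in> carrier G \<Longrightarrow> g \<noteq> \<one> \<Longrightarrow> n > 0 \<Longrightarrow> g [^] (n::nat) \<noteq> \<one>"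
    and h: "h \<in> hom (free_Abelian_group (carrier G)) G"
    and h_of: "\<And>x. x \<in> carrier G \<Longrightarrow> h (frag_of x) = x"
    and S: "fin_gen_set G S"
    and min: "\<And>T. fin_gen_set G T \<Longrightarrow> card S \<le> card T"
    and a: "Poly_Mapping.keys a \<subseteq> S" "h a = \<one>"
  shows "a = 0"
proof (rule ccontr)
  assume "a \<noteq> 0"
  let ?F = "free_Abelian_group (carrier G)"
  interpret h: group_hom ?F G h
    by (intro group_hom.intro group_hom_axioms.intro group_free_Abelian_group is_group h)
  have h_add: "h (b + c) = h b \<otimes> h c"
    if "Poly_Mapping.keys b \<subseteq> carrier G" "Poly_Mapping.keys c \<subseteq> carrier G" for b c
    using h.hom_mult [of b c] that by simp
  have h_cmul: "h (frag_cmul n (frag_of x)) = x [^] n" if "x \<in> carrier G" for n :: int and x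
    using h.hom_int_pow [of "frag_of x" n] that h_of by simp
  define good where "good T b \<longleftrightarrow> fin_gen_set G T \<and> card T = card S \<and>
      Poly_Mapping.keys b \<subseteq> T \<and> h b = \<one> \<and> b \<noteq> 0" for T b
  have "good S a"
    using S a \<open>a \<noteq> 0\<close> by (simp add: good_def)
  then obtain T b where Tb: "good T b"
    and least: "\<And>T' b'. good T' b' \<Longrightarrow> frag_norm b \<le> frag_norm b'"
    using ex_has_least_nat [of "\<lambda>(T, b). good T b" "(S, a)" "\<lambda>(T, b). frag_norm b"] by auto
  have T: "fin_gen_set G T" and cardT: "card T = card S"
    and b: "Poly_Mapping.keys b \<subseteq> T" "h b = \<one>" "b \<noteq> 0"
    using Tb unfolding good_def by blast+
  have fT: "finite T" and Tc: "T \<subseteq> carrier G"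
    using T unfolding fin_gen_set_def by blast+
  have drop: "\<not> fin_gen_set G (T - {x})" if "x \<in> T" for x
    using min [of "T - {x}"] card_Diff1_less [OF fT that] cardT by linarith
  obtain i j where ij: "i \<in> Poly_Mapping.keys b" "j \<in> Poly_Mapping.keys b" "i \<noteq> j"
    and le: "\<bar>lookup b j\<bar> \<le> \<bar>lookup b i\<bar>"
  proof -
    obtain s where s: "s \<in> Poly_Mapping.keys b"
      using b(3) by (metis all_not_in_conv keys_eq_empty)
    have "Poly_Mapping.keys b \<noteq> {s}"
    proof
      assume ks: "Poly_Mapping.keys b = {s}"
      define c where "c = lookup b s"
      have "b = frag_cmul c (frag_of s)"
        by (rule poly_mapping_eqI)
          (use ks in \<open>auto simp: c_def lookup_frag_of in_keys_iff set_eq_iff\<close>)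
      moreover have sT: "s \<in> T" and sc: "s \<in> carrier G"
        using s b Tc by auto
      ultimately have pow: "s [^] c = \<one>"
        using b(2) h_cmul by metis
      have "s [^] nat \<bar>c\<bar> = \<one>"
      proof (cases "c \<ge> 0")
        case True
        then show ?thesis
          using pow by (simp add: pow_nat)
      next
        case False
        then have "s [^] (- c) = \<one>"
          using pow sc by (simp add: int_pow_neg)
        with False show ?thesis
          by (simp add: pow_nat)
      qed
      moreover have "c \<noteq> 0"
        using s by (simp add: c_def in_keys_iff)
      ultimately have "s = \<one>"
        using tf [of s "nat \<bar>c\<bar>"] sc by auto
      then have "T \<subseteq> generate G (T - {s})"
        by (auto intro: generate.one generate.incl)
      then have "fin_gen_set G (T - {s})"
        using fT Tc by (intro fin_gen_set_transfer [OF T]) auto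
      with drop sT show False by blast
    qed
    then obtain t where "t \<in> Poly_Mapping.keys b" "t \<noteq> s"
      using s by blast
    with s show thesis
      using that [of s t] that [of t s] by (cases "\<bar>lookup b t\<bar> \<le> \<bar>lookup b s\<bar>") auto
  qed
  have ijT: "i \<in> T" "j \<in> T" and ijc: "i \<in> carrier G" "j \<in> carrier G"
    using ij b Tc by auto
  define bi bj where "bi = lookup b i" and "bj = lookup b j"
  define e :: int where "e = sgn bi * sgn bj"
  have nz: "bi \<noteq> 0" "bj \<noteq> 0"
    using ij by (auto simp: bi_def bj_def in_keys_iff)
  define t where "t = j \<otimes> i [^] e"
  have tc: "t \<in> carrier G"
    using ijc by (simp add: t_def)
  let ?T' = "insert t (T - {j})"
  have j_eq: "j = t \<otimes> i [^] (- e)"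
    using ijc by (simp add: t_def m_assoc int_pow_neg)
  have gen': "fin_gen_set G ?T'"
  proof (rule fin_gen_set_transfer [OF T])
    have i: "i \<in> generate G ?T'"
      using ijT ij by (auto intro: generate.incl)
    have T'c: "?T' \<subseteq> carrier G"
      using Tc tc by auto
    have "i [^] (- e) \<in> generate G ?T'"
      using i by (intro subgroup_int_pow_closed generate_is_subgroup T'c)
    then have "j \<in> generate G ?T'"
      by (subst j_eq) (auto intro: generate.eng generate.incl)
    then show "T \<subseteq> generate G ?T'"
      by (auto intro: generate.incl)
  qed (use fT Tc tc in auto)
  \<comment> \<open>Otherwise the new generating set would be \<open>T - {j}\<close>, which is too small. The case \<open>t = j\<close>
    is not excluded; the lookups below cover it.\<close>
  have t_new: "t \<notin> T - {j}"
    using gen' drop ijT by (metis insert_absorb)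
  have ti: "t \<noteq> i"
    using t_new ijT ij(3) by blast
  have off: "lookup b k = 0" if "k \<notin> T" for k
    using that b(1) by (auto simp: in_keys_iff)
  then have lt: "lookup b t = (if t = j then bj else 0)"
    using t_new by (auto simp: bj_def)
  let ?b1 = "b + frag_cmul (- bj) (frag_of j)"
  let ?b2 = "?b1 + frag_cmul (- (e * bj)) (frag_of i)"
  let ?b' = "?b2 + frag_cmul bj (frag_of t)"
  have l1: "lookup ?b1 i = bi" "lookup ?b2 t = 0"
    using ij(3) ti lt by (simp_all add: lookup_add bi_def)
  have "frag_norm ?b' \<le> frag_norm ?b2 + nat \<bar>bj\<bar>"
    using frag_norm_add_le [of ?b2 "frag_cmul bj (frag_of t)"] by simp
  also have "\<dots> < frag_norm b"
  proof -
    have 1: "frag_norm b = frag_norm ?b1 + nat \<bar>bj\<bar>"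
      using frag_norm_update [of b j "- bj"] by (simp add: bj_def)
    have 2: "frag_norm ?b1 + nat \<bar>bi - e * bj\<bar> = frag_norm ?b2 + nat \<bar>bi\<bar>"
      using frag_norm_update [of ?b1 i "- (e * bj)"] l1 by simp
    have "nat \<bar>bi - e * bj\<bar> < nat \<bar>bi\<bar>"
      using nz le unfolding e_def bi_def [symmetric] bj_def [symmetric]
      by (auto simp: sgn_if split: if_splits)
    with 1 2 show ?thesis by linarith
  qed
  finally have smaller: "frag_norm ?b' < frag_norm b" .
  have "good ?T' ?b'"
    unfolding good_def
  proof (intro conjI gen')
    show "card ?T' = card S"
      using t_new fT ijT cardT card_Suc_Diff1 [of T j] by simp
    show "Poly_Mapping.keys ?b' \<subseteq> ?T'"
    proof
      fix k assume k: "k \<in> Poly_Mapping.keys ?b'"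
      show "k \<in> ?T'"
      proof (rule ccontr)
        assume nk: "k \<notin> ?T'"
        then have "k \<noteq> t" "k \<noteq> i" "k = j \<or> k \<notin> T"
          using ij(3) ijT by auto
        then have "lookup ?b' k = 0"
          using off [of k] ijT by (cases "k = j") (simp_all add: lookup_add bj_def)
        with k show False
          by (simp add: in_keys_iff)
      qed
    qed
    have "lookup ?b' t \<noteq> 0"
      using l1 nz by (simp add: lookup_add)
    then show "?b' \<noteq> 0"
      by auto
    have keys_gen: "Poly_Mapping.keys (frag_cmul c (frag_of x)) \<subseteq> carrier G"
      if "x \<in> carrier G" for c x
      using that by auto
    have keys_add_frag: "Poly_Mapping.keys (c + d) \<subseteq> carrier G"
      if "Poly_Mapping.keys c \<subseteq> carrier G" "Poly_Mapping.keys d \<subseteq> carrier G" for c d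
      using that keys_add [of c d] by blast
    have bc: "Poly_Mapping.keys b \<subseteq> carrier G"
      using b(1) Tc by blast
    have keys: "Poly_Mapping.keys ?b1 \<subseteq> carrier G"
      "Poly_Mapping.keys ?b2 \<subseteq> carrier G"
      by (intro keys_add_frag keys_gen ijc bc)+
    have "h ?b' = j [^] (- bj) \<otimes> i [^] (- (e * bj)) \<otimes> t [^] bj"
      using b(2) bc keys keys_gen ijc tc by (simp add: h_add h_cmul)
    also have "t [^] bj = j [^] bj \<otimes> i [^] (e * bj)"
      using ijc by (simp add: t_def int_pow_distrib int_pow_pow)
    also have "j [^] (- bj) \<otimes> i [^] (- (e * bj)) \<otimes> (j [^] bj \<otimes> i [^] (e * bj)) =
        (j [^] (- bj) \<otimes> j [^] bj) \<otimes> (i [^] (- (e * bj)) \<otimes> i [^] (e * bj))"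
      using ijc by (simp add: m_ac)
    also have "\<dots> = \<one>"
      using ijc by (simp add: int_pow_neg)
    finally show "h ?b' = \<one>" .
  qed
  then show False
    using least smaller by (metis not_le)
qed

text \<open>The free abelian group on an independent generating set maps isomorphically onto \<open>G\<close>.\<close>

lemma (in comm_group) torsion_free_imp_free_abelian:
  assumes tf: "\<And>g n. g \<in> carrier G \<Longrightarrow> g \<noteq> \<one> \<Longrightarrow> n > 0 \<Longrightarrow> g [^] (n::nat) \<noteq> \<one>"
    and "fin_gen_set G S0"
  shows "is_free_abelian G"
proof -
  obtain h :: "('a \<Rightarrow>\<^sub>0 int) \<Rightarrow> 'a" where h: "h \<in> hom (free_Abelian_group (carrier G)) G"
    and h_of: "\<And>x. x \<in> carrier G \<Longrightarrow> h (frag_of x) = x"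
    using free_Abelian_group_universal [of id "carrier G"] by auto
  obtain S where S: "fin_gen_set G S" and min: "\<And>T. fin_gen_set G T \<Longrightarrow> card S \<le> card T"
    using ex_has_least_nat [of "fin_gen_set G" S0 card] assms(2) by blast
  have Sc: "S \<subseteq> carrier G" "generate G S = carrier G"
    using S by (auto simp: fin_gen_set_def)
  have hS: "h \<in> hom (free_Abelian_group S) G"
    using h Sc by (auto simp: hom_def Pi_iff)
  interpret h: group_hom "free_Abelian_group S" G h
    by (intro group_hom.intro group_hom_axioms.intro group_free_Abelian_group is_group hS)
  have "kernel (free_Abelian_group S) G h = {\<one>\<^bsub>free_Abelian_group S\<^esub>}"
    using minimal_generators_independent [OF tf h h_of S min] h.hom_one
    by (auto simp: kernel_def)
  then have "inj_on h (carrier (free_Abelian_group S))"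
    by (simp add: h.inj_iff_trivial_ker)
  moreover have "h ` carrier (free_Abelian_group S) = carrier G"
  proof
    have "S \<subseteq> h ` carrier (free_Abelian_group S)"
    proof
      fix x assume "x \<in> S"
      then show "x \<in> h ` carrier (free_Abelian_group S)"
        using h_of [of x] Sc by (intro image_eqI [of _ _ "frag_of x"]) auto
    qed
    then show "carrier G \<subseteq> h ` carrier (free_Abelian_group S)"
      using generate_subgroup_incl h.img_is_subgroup Sc by metis
  qed auto
  ultimately have "h \<in> iso (free_Abelian_group S) G"
    using hS by (simp add: iso_def bij_betw_def)
  then have "free_Abelian_group S \<cong> G"
    by (rule is_isoI)
  then have "G \<cong> free_Abelian_group S"
    by (simp add: group.iso_sym)
  then show ?thesis
    by (auto simp: is_free_abelian_def)
qed

section \<open>Letter sets and the geodesics of a free abelian group\<close>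

text \<open>For \<open>k = 1\<close> the prefixes and suffixes of length \<open>k - 1\<close> are empty, and the subwords of length 1
  are the letters.\<close>

lemma locally_testable_1_iff:
  "locally_testable 1 X L \<longleftrightarrow>
    L \<subseteq> lists X \<and> (\<forall>u\<in>L. \<forall>v\<in>lists X. set v = set u \<longrightarrow> v \<in> L)"
proof -
  define R where "R = loc_rel 1 X"
  have "sub 1 w = (\<lambda>x. [x]) ` set w" for w :: "'a list"
    by (auto simp: sub_def length_Suc_conv sublist_def in_set_conv_decomp)
  then have rel: "(u, v) \<in> R \<longleftrightarrow> u \<in> lists X \<and> v \<in> lists X \<and> set u = set v" for u v
    by (auto simp: R_def loc_rel_def pre_def suf_def inj_image_eq_iff inj_def)
  show ?thesis
  proof
    assume "locally_testable 1 X L"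
    then obtain C where C: "C \<subseteq> lists X // R" "L = \<Union>C"
      by (auto simp: locally_testable_def R_def)
    have cls: "\<exists>w. u \<in> R `` {w} \<and> R `` {w} \<subseteq> L" if "u \<in> L" for u
      using that C by (blast elim: quotientE)
    show "L \<subseteq> lists X \<and> (\<forall>u\<in>L. \<forall>v\<in>lists X. set v = set u \<longrightarrow> v \<in> L)"
    proof (intro conjI ballI impI subsetI)
      show "u \<in> lists X" if "u \<in> L" for u
        using cls [OF that] by (auto simp: rel)
      show "v \<in> L" if "u \<in> L" "v \<in> lists X" "set v = set u" for u v
        using cls [OF that(1)] that(2,3) by (auto simp: rel subset_iff)
    qed
  next
    assume L: "L \<subseteq> lists X \<and> (\<forall>u\<in>L. \<forall>v\<in>lists X. set v = set u \<longrightarrow> v \<in> L)"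
    have "u \<in> R `` {u}" "R `` {u} \<subseteq> L" if "u \<in> L" for u
      using L that by (auto simp: rel)
    then have "L = \<Union>((\<lambda>u. R `` {u}) ` L)"
      by blast
    moreover have "(\<lambda>u. R `` {u}) ` L \<subseteq> lists X // R"
      using L by (auto simp: quotient_def)
    ultimately show "locally_testable 1 X L"
      unfolding locally_testable_def R_def by (metis zero_less_one)
  qed
qed

lemma locally_testable_1_imp_SS_idempotent:
  assumes "locally_testable 1 X L"
  shows "SS_idempotent X L"
  unfolding SS_idempotent_def
proof
  fix A assume "A \<in> SS X L"
  then obtain u where u: "u \<in> nonempty_words X" "A = syn_rel X L `` {u}"
    by (auto simp: SS_def quotient_def)
  have "s @ (u @ u) @ t \<in> L \<longleftrightarrow> s @ u @ t \<in> L" if "s \<in> lists X" "t \<in> lists X" for s t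
  proof -
    have "s @ (u @ u) @ t \<in> lists X" "s @ u @ t \<in> lists X"
      "set (s @ (u @ u) @ t) = set (s @ u @ t)"
      using that u by (auto simp: nonempty_words_def)
    with assms show ?thesis
      unfolding locally_testable_1_iff by metis
  qed
  then have "(u @ u, u) \<in> syn_rel X L"
    using u by (auto simp: syn_rel_def nonempty_words_def)
  then show "SS_mult X L A A = A"
    using u equiv_class_eq [OF equiv_syn_rel] by (simp add: SS_mult_class)
qed

lemma (in group) hom_integer_word_value:
  assumes "f \<in> hom G integer_group" "set w \<subseteq> carrier G"
  shows "f (word_value G w) = sum_list (map f w)"
  using assms(2)
proof (induction w)
  case Nil
  show ?case
    using hom_one [OF assms(1) is_group] by simp
next
  case (Cons x w)
  then show ?case
    using assms(1) by (simp add: hom_def)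
qed

lemma (in comm_group) word_value_remove1:
  "set w \<subseteq> carrier G \<Longrightarrow> x \<in> set w \<Longrightarrow> word_value G w = x \<otimes> word_value G (remove1 x w)"
proof (induction w)
  case (Cons y w)
  have "set (remove1 x w) \<subseteq> carrier G"
    using Cons.prems set_remove1_subset [of x w] by auto
  with Cons show ?case
    by (auto simp: m_lcomm)
qed simp

text \<open>The finitely many basis elements that occur in the generators already generate everything.\<close>

lemma (in group) finite_free_abelian_basis:
  assumes h: "h \<in> iso (free_Abelian_group S) G" and T: "fin_gen_set G T"
  shows "finite S"
proof -
  interpret h: group_hom "free_Abelian_group S" G h
    using h by (intro group_hom.intro group_hom_axioms.intro group_free_Abelian_group is_group)
      (simp add: iso_def)
  have T: "finite T" "generate G T = carrier G" "T \<subseteq> carrier G"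
    using T by (auto simp: fin_gen_set_def)
  have onto: "carrier G = h ` carrier (free_Abelian_group S)"
    using h by (auto simp: iso_def bij_betw_def)
  have "\<forall>t\<in>T. \<exists>a. Poly_Mapping.keys a \<subseteq> S \<and> h a = t"
  proof
    fix t assume "t \<in> T"
    then obtain a where "a \<in> carrier (free_Abelian_group S)" "t = h a"
      using T onto by blast
    then show "\<exists>a. Poly_Mapping.keys a \<subseteq> S \<and> h a = t"
      by (metis carrier_free_Abelian_group_iff)
  qed
  then obtain f where f: "\<And>t. t \<in> T \<Longrightarrow> Poly_Mapping.keys (f t) \<subseteq> S \<and> h (f t) = t"
    by metis
  define U where "U = (\<Union>t\<in>T. Poly_Mapping.keys (f t))"
  have U: "U \<subseteq> S" "finite U"
    using f T by (auto simp: U_def)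
  have "subgroup (carrier (free_Abelian_group U)) (free_Abelian_group S)"
  proof (rule group.subgroupI [OF group_free_Abelian_group])
    have "0 \<in> carrier (free_Abelian_group U)"
      by simp
    then show "carrier (free_Abelian_group U) \<noteq> {}"
      by blast
    fix a b assume ab: "a \<in> carrier (free_Abelian_group U)" "b \<in> carrier (free_Abelian_group U)"
    show "a \<otimes>\<^bsub>free_Abelian_group S\<^esub> b \<in> carrier (free_Abelian_group U)"
      using ab keys_add [of a b] by auto
  qed (use U in auto)
  then have "subgroup (h ` carrier (free_Abelian_group U)) G"
    by (rule h.subgroup_img_is_subgroup)
  moreover have "T \<subseteq> h ` carrier (free_Abelian_group U)"
  proof
    fix t assume t: "t \<in> T"
    then have "f t \<in> carrier (free_Abelian_group U)"
      by (auto simp: U_def)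
    then show "t \<in> h ` carrier (free_Abelian_group U)"
      using f [OF t] by (metis imageI)
  qed
  ultimately have sur: "carrier G \<subseteq> h ` carrier (free_Abelian_group U)"
    using generate_subgroup_incl T by metis
  have "S \<subseteq> U"
  proof
    fix s assume s: "s \<in> S"
    then have "h (frag_of s) \<in> carrier G"
      by simp
    then have "h (frag_of s) \<in> h ` carrier (free_Abelian_group U)"
      using sur by blast
    then obtain a where "a \<in> carrier (free_Abelian_group U)" and ha: "h (frag_of s) = h a"
      by (rule imageE)
    then have a: "Poly_Mapping.keys a \<subseteq> U"
      by simp
    have "inj_on h (carrier (free_Abelian_group S))"
      using h by (auto simp: iso_def bij_betw_def)
    then have "frag_of s = a"
      by (rule inj_onD [of h]) (use ha s a U in auto)
    with a show "s \<in> U"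
      by auto
  qed
  with U show ?thesis
    using finite_subset by blast
qed

text \<open>Cancelling a letter against its inverse shortens a word, as \<open>G\<close> is abelian. Conversely, that a
  word \<open>u\<close> without inverse pairs is geodesic is certified by a homomorphism \<open>\<psi>\<close> to the integers
  that sends each letter to \<open>1\<close> or \<open>-1\<close> and those of \<open>u\<close> to \<open>1\<close>: the value of \<open>u\<close> is sent to the
  length of \<open>u\<close>, and the value of any word to at most its length.\<close>

lemma (in group) free_abelian_imp_locally_testable_1:
  assumes "is_free_abelian G" "fin_gen_set G T"
  shows "locally_testable_group 1 G"
proof -
  obtain S :: "'a set" where "G \<cong> free_Abelian_group S"
    using assms(1) by (auto simp: is_free_abelian_def)
  then have "free_Abelian_group S \<cong> G"
    by (rule iso_sym)
  then obtain h where iso: "h \<in> iso (free_Abelian_group S) G"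
    by (auto simp: is_iso_def)
  interpret comm_group G
    by (rule comm_group.iso_imp_comm_group [OF abelian_free_Abelian_group
          \<open>free_Abelian_group S \<cong> G\<close> is_monoid])
  have finS: "finite S"
    using finite_free_abelian_basis [OF iso assms(2)] .
  interpret h: group_hom "free_Abelian_group S" G h
    using iso by (intro group_hom.intro group_hom_axioms.intro group_free_Abelian_group is_group)
      (simp add: iso_def)
  have inj: "h a = h b \<longleftrightarrow> a = b" if "Poly_Mapping.keys a \<subseteq> S" "Poly_Mapping.keys b \<subseteq> S" for a b
    using iso that by (auto simp: iso_def bij_betw_def inj_on_def)
  obtain g where g: "g \<in> iso G (free_Abelian_group S)"
    and gh: "\<And>a. Poly_Mapping.keys a \<subseteq> S \<Longrightarrow> g (h a) = a"
  proof
    show "inv_into (carrier (free_Abelian_group S)) h \<in> iso G (free_Abelian_group S)"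
      using group.iso_set_sym [OF group_free_Abelian_group iso] .
    show "inv_into (carrier (free_Abelian_group S)) h (h a) = a" if "Poly_Mapping.keys a \<subseteq> S" for a
      using iso that by (auto simp: iso_def bij_betw_def inv_into_f_f)
  qed
  define e where "e s = h (frag_of s)" for s
  have e: "e s \<in> carrier G" if "s \<in> S" for s
    using that by (simp add: e_def)
  have inv_e: "inv (e s) = h (- frag_of s)" if "s \<in> S" for s
    using that h.hom_inv [of "frag_of s"] by (simp add: e_def)
  define X where "X = e ` S \<union> (\<lambda>s. inv (e s)) ` S"
  have X_carrier: "X \<subseteq> carrier G"
    using e by (auto simp: X_def)
  have "h a \<in> generate G X" if "Poly_Mapping.keys a \<subseteq> S" for a
    using that
  proof (rule free_Abelian_group_induct)
    show "h 0 \<in> generate G X"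
      using h.hom_one by (simp add: generate.one)
    show "h (frag_of s) \<in> generate G X" if "s \<in> S" for s
      using that by (auto simp: X_def e_def intro: generate.incl)
    fix a b assume ab: "Poly_Mapping.keys a \<subseteq> S" "Poly_Mapping.keys b \<subseteq> S"
      "h a \<in> generate G X" "h b \<in> generate G X"
    have "h (a - b) = h a \<otimes> inv (h b)"
      using ab h.hom_mult [of a "- b"] h.hom_inv [of b] by simp
    with ab show "h (a - b) \<in> generate G X"
      by (simp add: generate.eng generate_m_inv_closed [OF X_carrier])
  qed
  moreover have "carrier G = h ` carrier (free_Abelian_group S)"
    using iso by (auto simp: iso_def bij_betw_def)
  ultimately have "carrier G \<subseteq> generate G X"
    by auto
  then have gens: "fin_sym_gen_set G X"
    using finS e X_carrier generate_incl [OF X_carrier]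
    by (auto simp: fin_sym_gen_set_def X_def)
  then interpret sym_gen_group G X
    by unfold_locales
  \<comment> \<open>A letter equal to its inverse would form an inverse pair with itself in a geodesic word.\<close>
  have inv_ne: "inv x \<noteq> x" if "x \<in> X" for x
  proof -
    have "e s \<noteq> inv (e s)" if "s \<in> S" for s
    proof
      assume "e s = inv (e s)"
      then have "frag_of s = - frag_of s"
        using that inv_e inj by (simp add: e_def)
      then have "Poly_Mapping.lookup (frag_of s) s = Poly_Mapping.lookup (- frag_of s) s"
        by metis
      then show False by simp
    qed
    with \<open>x \<in> X\<close> e show ?thesis
      unfolding X_def by fastforce
  qed
  have Geo_iff: "u \<in> Geo G X \<longleftrightarrow> (\<forall>x\<in>set u. inv x \<notin> set u)" if u: "u \<in> lists X" for u
  proof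
    assume geo: "u \<in> Geo G X"
    show "\<forall>x\<in>set u. inv x \<notin> set u"
    proof (intro ballI notI)
      fix x assume x: "x \<in> set u" "inv x \<in> set u"
      let ?v = "remove1 x u" and ?w = "remove1 (inv x) (remove1 x u)"
      have "x \<in> X"
        using x u by auto
      then have ix: "inv x \<in> set ?v"
        using x inv_ne by (simp add: in_set_remove1)
      have sub: "set ?v \<subseteq> set u" "set ?w \<subseteq> set u"
        using set_remove1_subset [of x u] set_remove1_subset [of "inv x" ?v] by blast+
      then have w: "?w \<in> lists X" and c: "set ?v \<subseteq> carrier G" "set ?w \<subseteq> carrier G"
        using u X_carrier by auto
      have "word_value G u = x \<otimes> (inv x \<otimes> word_value G ?w)"
        using word_value_remove1 [of u x] word_value_remove1 [of ?v "inv x"] x ix c u by simp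
      then have "word_value G ?w = word_value G u"
        using \<open>x \<in> X\<close> c by (simp flip: m_assoc)
      then have "length u \<le> length ?w"
        using Geo_length_le [OF geo w] by simp
      moreover have "length ?w < length u"
        using x ix length_pos_if_in_set [OF x(1)] by (simp add: length_remove1)
      ultimately show False by simp
    qed
  next
    assume noinv: "\<forall>x\<in>set u. inv x \<notin> set u"
    define \<sigma> :: "'a \<Rightarrow> int" where "\<sigma> s = (if e s \<in> set u then 1 else - 1)" for s
    interpret Z: comm_group integer_group
      by (rule abelian_integer_group)
    obtain \<phi> where \<phi>: "\<phi> \<in> hom (free_Abelian_group S) integer_group"
      and \<phi>_of: "\<And>s. s \<in> S \<Longrightarrow> \<phi> (frag_of s) = \<sigma> s"
      using Z.free_Abelian_group_universal [of \<sigma> S] by auto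
    define \<psi> where "\<psi> = \<phi> \<circ> g"
    have \<psi>: "\<psi> \<in> hom G integer_group"
      unfolding \<psi>_def using g by (intro Group.hom_compose [OF _ \<phi>]) (simp add: iso_def)
    have \<psi>_e: "\<psi> (e s) = \<sigma> s" if "s \<in> S" for s
      using that gh \<phi>_of by (simp add: \<psi>_def e_def)
    have \<psi>_inv: "\<psi> (inv (e s)) = - \<sigma> s" if "s \<in> S" for s
    proof -
      interpret \<psi>: group_hom G integer_group \<psi>
        by (intro group_hom.intro group_hom_axioms.intro is_group Z.is_group \<psi>)
      show ?thesis
        using that e \<psi>_e \<psi>.hom_inv [of "e s"] by simp
    qed
    have le: "\<psi> x \<le> 1" if "x \<in> X" for x
      using that \<psi>_e \<psi>_inv by (auto simp: X_def \<sigma>_def)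
    have eq: "\<psi> x = 1" if "x \<in> set u" for x
    proof -
      from that u have "x \<in> X" by auto
      then show ?thesis
        using that noinv \<psi>_e \<psi>_inv e unfolding X_def \<sigma>_def by fastforce
    qed
    have "\<psi> (word_value G u) = int (length u)"
      using eq hom_integer_word_value [OF \<psi>, of u] u
      by (simp add: map_idI sum_list_triv cong: map_cong)
    moreover have "\<psi> (word_value G v) \<le> int (length v)" if v: "v \<in> lists X" for v
    proof -
      have "sum_list (map \<psi> v) \<le> int (length v)"
        using v
      proof (induction v)
        case (Cons x v)
        then show ?case using le [of x] by simp
      qed simp
      then show ?thesis
        using hom_integer_word_value [OF \<psi>, of v] v by simp
    qed
    ultimately have "length u \<le> length v"
      if "v \<in> lists X" "word_value G v = word_value G u" for v
      using that by (metis of_nat_le_iff)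
    then show "u \<in> Geo G X"
      unfolding Geo_def using u by (blast dest: leD)
  qed
  have "locally_testable 1 X (Geo G X)"
    unfolding locally_testable_1_iff using Geo_iff Geo_words by auto
  with gens show ?thesis
    by (auto simp: locally_testable_group_def)
qed

section \<open>The three characterisations\<close>

theorem theorem3p2:
  fixes G :: "('a, 'b) monoid_scheme"
  assumes "finitely_generated_group G"
  shows "(is_free_abelian G \<longleftrightarrow> locally_testable_group 1 G) \<and>
    (locally_testable_group 1 G \<longleftrightarrow>
      (\<exists>X. fin_sym_gen_set G X \<and> SS_idempotent X (Geo G X)))"
proof -
  interpret group G
    using assms by (simp add: finitely_generated_group_def)
  obtain T where T: "fin_gen_set G T"
    using assms by (auto simp: finitely_generated_group_def fin_gen_set_def)
  have "locally_testable_group 1 G" if "is_free_abelian G"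
    using free_abelian_imp_locally_testable_1 [OF that T] .
  moreover have "\<exists>X. fin_sym_gen_set G X \<and> SS_idempotent X (Geo G X)"
    if "locally_testable_group 1 G"
    using that locally_testable_1_imp_SS_idempotent unfolding locally_testable_group_def by blast
  moreover have "is_free_abelian G" if "fin_sym_gen_set G X" "SS_idempotent X (Geo G X)" for X
  proof -
    interpret idempotent_geodesics G X
      using that by unfold_locales
    show ?thesis
      using comm_group.torsion_free_imp_free_abelian [OF commutative torsion_free T] .
  qed
  ultimately show ?thesis by blast
qed

end
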